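(* Let $\Sigma$ be a seed, and let $f:\Sigma_{I_0,I_1}\rightarrow\Sigma$ and $f':\Sigma_{I'_0,I'_1}\rightarrow\Sigma$ be two regular elements of the semigroup $\mathrm{End}_{par}(\Sigma)$ of partial seed endomorphisms of $\Sigma$. Consider the statements (a) $f(\Sigma_{I_0,I_1})=f'(\Sigma_{I'_0,I'_1})$; (b) $\Sigma_{I_0,I_1}=\Sigma_{I'_0,I'_1}$; (c) there exists a seed isomorphism $g: f(\Sigma_{I_0,I_1})\rightarrow f'(\Sigma_{I'_0,I'_1})$ such that $f'=(id_{I''_0,I''_1}g)\circ f$, where $f'(\Sigma_{I'_0,I'_1})=\Sigma_{I''_0,I''_1}$. Then: (1) $f\mathcal{R}f'$ if and only if (a) holds. (2) $f\mathcal{L}f'$ if and only if (b) and (c) hold. (3) $f\mathcal{H}f'$ if and only if (a), (b) and (c) hold. (4) $f\mathcal{D}f'$ if and only if $f(\Sigma_{I_0,I_1})\cong f'(\Sigma_{I'_0,I'_1})$ as seeds.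
   Context: Seeds. A seed $\Sigma=(X,\widetilde B)$ consists of a finite set $\widetilde X=X\sqcup X_{fr}$ of variables algebraically independent over $\mathbb Q$ ($X$ exchangeable, $X_{fr}$ frozen) and an integer matrix $\widetilde B=(b_{xy})_{x\in X,\,y\in\widetilde X}$ whose principal part $(b_{xy})_{x,y\in X}$ is totally sign-skew-symmetric: every matrix obtained from it by finitely many matrix mutations is sign-skew-symmetric (for all $x,y$, either $a_{xy}=a_{yx}=0$ or $a_{xy}a_{yx}<0$). Matrix mutation in direction $i$ sends $(a_{jk})$ to $(a'_{jk})$ with $a'_{jk}=-a_{jk}$ if $j=i$ or $k=i$, and $a'_{jk}=a_{jk}+\frac{|a_{ji}|a_{ik}+a_{ji}|a_{ik}|}{2}$ otherwise. The empty seed is allowed. Seed homomorphisms. Pairs $(x,y),(z,w)$ with $x,z\in X$, $y,w\in\widetilde X$ are adjacent if $b_{xz}\neq0$ or $x=z$. A seed homomorphism $f:\Sigma\to\Sigma'$ is a map $f:\widetilde X\to\widetilde X'$ with $f(X)\subseteq X'$ such that for all adjacent pairs $(x,y),(z,w)$ one has $(b'_{f(x)f(y)}b_{xy})(b'_{f(z)f(w)}b_{zw})\ge 0$ and $|b'_{f(x)f(y)}|\ge|b_{xy}|$. It is a seed isomorphism if it induces bijections $X\to X'$ and $\widetilde X\to\widetilde X'$ and $|b_{xy}|=|b'_{f(x)f(y)}|$ for all $x\in X,y\in\widetilde X$. The image seed $f(\Sigma)$ has exchangeable cluster $f(X)$, extended cluster $f(\widetilde X)$ and matrix entries $b'_{xy}$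 ($x\in f(X)$, $y\in f(\widetilde X)$). Mixing-type sub-seeds. For $I_0\subseteq X$, $I_1\subseteq\widetilde X$ with $I_0\cap I_1=\emptyset$, the sub-seed $\Sigma_{I_0,I_1}$ has exchangeable cluster $X\setminus(I_0\cup I_1)$, extended cluster $\widetilde X\setminus I_1$, and the entries of $\widetilde B$ restricted accordingly. An image seed of a seed homomorphism into $\Sigma$ is a mixing-type sub-seed of $\Sigma$. Partial seed endomorphisms. An element of $\mathrm{End}_{par}(\Sigma)$ is a seed homomorphism $f:\Sigma_f\to\Sigma$ with $\Sigma_f=\Sigma_{I_0,I_1}$ a mixing-type sub-seed of $\Sigma$ (the sub-seed is part of the data; the empty homomorphism $\emptyset$ is allowed). Put $Dom(f)=\widetilde X\setminus I_1$, $Dom(f)_{ex}=X\setminus(I_0\cup I_1)$, $Dom(f)_{fr}=(X_{fr}\cup I_0)\setminus I_1$. The composition $g\circ f$ has $Dom(g\circ f)_{ex}=\{x\in Dom(f)_{ex}: f(x)\in Dom(g)_{ex}\}$, $Dom(g\circ f)_{fr}=\{x\in Dom(f)_{fr}: f(x)\in Dom(g)_{fr}\}$, and $(g\circ f)(x)=g(f(x))$ on $Dom(g\circ f)=Dom(g\circ f)_{ex}\cup Dom(g\circ f)_{fr}$; its source is the mixing-type sub-seed with these exchangeable and frozen variables. With $\circ$ as multiplication $\mathrm{End}_{par}(\Sigma)$ is a semigroup. $id_{I_0,I_1}:\Sigma_{I_0,I_1}\to\Sigma$ is the inclusion of variables. For a seed homomorphism $g$ with target $\Sigma_{I''_0,I''_1}$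 and source a mixing-type sub-seed of $\Sigma$, $id_{I''_0,I''_1}g$ denotes the ordinary composition of maps, viewed as an element of $\mathrm{End}_{par}(\Sigma)$. Green's relations on a semigroup $S$: $x\mathcal Ly$ iff $Sx\cup\{x\}=Sy\cup\{y\}$; $x\mathcal Ry$ iff $xS\cup\{x\}=yS\cup\{y\}$; $\mathcal H=\mathcal L\wedge\mathcal R$; $\mathcal D=\mathcal L\vee\mathcal R=\mathcal L\circ\mathcal R=\mathcal R\circ\mathcal L$. An element $x\in S$ is regular if $xyx=x$ for some $y\in S$. *)

theory Defs
  imports Complex_Main "HOL-Library.FuncSet" "HOL-Library.Poly_Mapping"
begin

section \<open>Seeds\<close>

text \<open>
  A polynomial over the rationals in variables from \<open>'a\<close> is a finitely supported map from
  monomials (finitely supported exponent functions) to its coefficients.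
\<close>

definition algebraically_independent_over_rat :: "'a::field_char_0 set \<Rightarrow> bool" where
  "algebraically_independent_over_rat S \<longleftrightarrow>
    (\<forall>p :: ('a \<Rightarrow>\<^sub>0 nat) \<Rightarrow>\<^sub>0 rat.
       (\<forall>m\<in>Poly_Mapping.keys p. Poly_Mapping.keys m \<subseteq> S) \<longrightarrow>
       (\<Sum>m\<in>Poly_Mapping.keys p. of_rat (Poly_Mapping.lookup p m) *
          (\<Prod>x\<in>Poly_Mapping.keys m. x ^ Poly_Mapping.lookup m x)) = 0 \<longrightarrow>
       p = 0)"

text \<open>The sum \<open>\<bar>a\<bar> * b + a * \<bar>b\<bar>\<close> is \<open>0\<close> or \<open>\<plusminus>2 * a * b\<close>, so the integer division is exact.\<close>

definition matrix_mutation :: "'a \<Rightarrow> ('a \<Rightarrow> 'a \<Rightarrow> int) \<Rightarrow> ('a \<Rightarrow> 'a \<Rightarrow> int)" where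
  "matrix_mutation i a = (\<lambda>j k. if j = i \<or> k = i then - a j k
     else a j k + (\<bar>a j i\<bar> * a i k + a j i * \<bar>a i k\<bar>) div 2)"

definition sign_skew_symmetric :: "'a set \<Rightarrow> ('a \<Rightarrow> 'a \<Rightarrow> int) \<Rightarrow> bool" where
  "sign_skew_symmetric X a \<longleftrightarrow>
    (\<forall>x\<in>X. \<forall>y\<in>X. (a x y = 0 \<and> a y x = 0) \<or> a x y * a y x < 0)"

definition totally_sign_skew_symmetric :: "'a set \<Rightarrow> ('a \<Rightarrow> 'a \<Rightarrow> int) \<Rightarrow> bool" where
  "totally_sign_skew_symmetric X a \<longleftrightarrow>
    (\<forall>is. set is \<subseteq> X \<longrightarrow> sign_skew_symmetric X (fold matrix_mutation is a))"

record 'a seed =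
  exch :: "'a set"
  froz :: "'a set"
  entry :: "'a \<Rightarrow> 'a \<Rightarrow> int"

definition ext :: "'a seed \<Rightarrow> 'a set" where
  "ext \<Sigma> = exch \<Sigma> \<union> froz \<Sigma>"

text \<open>
  Matrices indexed by \<open>exch \<Sigma> \<times> ext \<Sigma>\<close> are total functions that vanish outside this
  index set, so that equality of seeds is equality of records.
\<close>

definition is_seed :: "'a::field_char_0 seed \<Rightarrow> bool" where
  "is_seed \<Sigma> \<longleftrightarrow>
     finite (ext \<Sigma>) \<and> exch \<Sigma> \<inter> froz \<Sigma> = {} \<and>
     algebraically_independent_over_rat (ext \<Sigma>) \<and>
     totally_sign_skew_symmetric (exch \<Sigma>) (entry \<Sigma>) \<and>
     (\<forall>x y. \<not> (x \<in> exch \<Sigma> \<and> y \<in> ext \<Sigma>) \<longrightarrow> entry \<Sigma> x y = 0)"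

text \<open>The seed with exchangeable variables \<open>E\<close>, frozen variables \<open>F\<close> and the entries of \<open>\<Sigma>\<close>.\<close>

definition restrict_seed :: "'a seed \<Rightarrow> 'a set \<Rightarrow> 'a set \<Rightarrow> 'a seed" where
  "restrict_seed \<Sigma> E F =
     \<lparr>exch = E, froz = F,
      entry = (\<lambda>x y. if x \<in> E \<and> y \<in> E \<union> F then entry \<Sigma> x y else 0)\<rparr>"

definition mixing_pair :: "'a seed \<Rightarrow> 'a set \<Rightarrow> 'a set \<Rightarrow> bool" where
  "mixing_pair \<Sigma> I0 I1 \<longleftrightarrow> I0 \<subseteq> exch \<Sigma> \<and> I1 \<subseteq> ext \<Sigma> \<and> I0 \<inter> I1 = {}"

definition mixing_subseed :: "'a seed \<Rightarrow> 'a set \<Rightarrow> 'a set \<Rightarrow> 'a seed" where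
  "mixing_subseed \<Sigma> I0 I1 =
     restrict_seed \<Sigma> (exch \<Sigma> - (I0 \<union> I1)) ((froz \<Sigma> \<union> I0) - I1)"


section \<open>Seed homomorphisms\<close>

definition adjacent :: "'a seed \<Rightarrow> 'a \<times> 'a \<Rightarrow> 'a \<times> 'a \<Rightarrow> bool" where
  "adjacent \<Sigma> p q \<longleftrightarrow>
     fst p \<in> exch \<Sigma> \<and> snd p \<in> ext \<Sigma> \<and> fst q \<in> exch \<Sigma> \<and> snd q \<in> ext \<Sigma> \<and>
     (entry \<Sigma> (fst p) (fst q) \<noteq> 0 \<or> fst p = fst q)"

definition seed_hom :: "'a seed \<Rightarrow> 'a seed \<Rightarrow> ('a \<Rightarrow> 'a) \<Rightarrow> bool" where
  "seed_hom \<Sigma> \<Sigma>' f \<longleftrightarrow>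
     f ` ext \<Sigma> \<subseteq> ext \<Sigma>' \<and> f ` exch \<Sigma> \<subseteq> exch \<Sigma>' \<and>
     (\<forall>x y z w. adjacent \<Sigma> (x, y) (z, w) \<longrightarrow>
        (entry \<Sigma>' (f x) (f y) * entry \<Sigma> x y) * (entry \<Sigma>' (f z) (f w) * entry \<Sigma> z w) \<ge> 0 \<and>
        \<bar>entry \<Sigma>' (f x) (f y)\<bar> \<ge> \<bar>entry \<Sigma> x y\<bar>)"

definition seed_iso :: "'a seed \<Rightarrow> 'a seed \<Rightarrow> ('a \<Rightarrow> 'a) \<Rightarrow> bool" where
  "seed_iso \<Sigma> \<Sigma>' f \<longleftrightarrow>
     seed_hom \<Sigma> \<Sigma>' f \<and> bij_betw f (exch \<Sigma>) (exch \<Sigma>') \<and> bij_betw f (ext \<Sigma>) (ext \<Sigma>') \<and>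
     (\<forall>x\<in>exch \<Sigma>. \<forall>y\<in>ext \<Sigma>. \<bar>entry \<Sigma> x y\<bar> = \<bar>entry \<Sigma>' (f x) (f y)\<bar>)"

definition isomorphic_seeds :: "'a seed \<Rightarrow> 'a seed \<Rightarrow> bool" where
  "isomorphic_seeds \<Sigma> \<Sigma>' \<longleftrightarrow> (\<exists>f. seed_iso \<Sigma> \<Sigma>' f)"

text \<open>The image of \<open>f : \<Sigma> \<rightarrow> \<Sigma>'\<close>; its extended cluster is \<open>f ` ext \<Sigma>\<close>.\<close>

definition image_seed :: "('a \<Rightarrow> 'a) \<Rightarrow> 'a seed \<Rightarrow> 'a seed \<Rightarrow> 'a seed" where
  "image_seed f \<Sigma> \<Sigma>' = restrict_seed \<Sigma>' (f ` exch \<Sigma>) (f ` ext \<Sigma> - f ` exch \<Sigma>)"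


section \<open>Partial seed endomorphisms\<close>

text \<open>
  The source is part of the data. The map is \<open>undefined\<close> outside the extended cluster of the
  source, so that equality of partial endomorphisms is equality of records.
\<close>

record 'a partial_hom =
  source :: "'a seed"
  fun_of :: "'a \<Rightarrow> 'a"

definition End_par :: "'a seed \<Rightarrow> 'a partial_hom set" where
  "End_par \<Sigma> =
     {f. (\<exists>I0 I1. mixing_pair \<Sigma> I0 I1 \<and> source f = mixing_subseed \<Sigma> I0 I1) \<and>
         seed_hom (source f) \<Sigma> (fun_of f) \<and> fun_of f \<in> extensional (ext (source f))}"

text \<open>\<open>par_comp \<Sigma> g f\<close> is \<open>g \<circ> f\<close>.\<close>

definition par_comp :: "'a seed \<Rightarrow> 'a partial_hom \<Rightarrow> 'a partial_hom \<Rightarrow> 'a partial_hom" where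
  "par_comp \<Sigma> g f =
     (let E = {x \<in> exch (source f). fun_of f x \<in> exch (source g)};
          F = {x \<in> froz (source f). fun_of f x \<in> froz (source g)}
      in \<lparr>source = restrict_seed \<Sigma> E F, fun_of = compose (E \<union> F) (fun_of g) (fun_of f)\<rparr>)"

definition id_par :: "'a seed \<Rightarrow> 'a set \<Rightarrow> 'a set \<Rightarrow> 'a partial_hom" where
  "id_par \<Sigma> I0 I1 =
     \<lparr>source = mixing_subseed \<Sigma> I0 I1,
      fun_of = restrict (\<lambda>x. x) (ext (mixing_subseed \<Sigma> I0 I1))\<rparr>"

text \<open>
  The ordinary composite of a partial endomorphism \<open>h\<close> with a seed homomorphism
  \<open>g : \<Sigma>1 \<rightarrow> source h\<close>; in contrast to \<open>par_comp\<close>, its source is all of \<open>\<Sigma>1\<close>.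
\<close>

definition comp_hom :: "'a partial_hom \<Rightarrow> ('a \<Rightarrow> 'a) \<Rightarrow> 'a seed \<Rightarrow> 'a partial_hom" where
  "comp_hom h g \<Sigma>1 = \<lparr>source = \<Sigma>1, fun_of = compose (ext \<Sigma>1) (fun_of h) g\<rparr>"


section \<open>Green's relations and regularity for a semigroup with carrier \<open>S\<close> and product \<open>m\<close>\<close>

definition green_L :: "'s set \<Rightarrow> ('s \<Rightarrow> 's \<Rightarrow> 's) \<Rightarrow> ('s \<times> 's) set" where
  "green_L S m = {(x, y). x \<in> S \<and> y \<in> S \<and>
     (\<lambda>s. m s x) ` S \<union> {x} = (\<lambda>s. m s y) ` S \<union> {y}}"

definition green_R :: "'s set \<Rightarrow> ('s \<Rightarrow> 's \<Rightarrow> 's) \<Rightarrow> ('s \<times> 's) set" where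
  "green_R S m = {(x, y). x \<in> S \<and> y \<in> S \<and>
     (\<lambda>s. m x s) ` S \<union> {x} = (\<lambda>s. m y s) ` S \<union> {y}}"

definition green_H :: "'s set \<Rightarrow> ('s \<Rightarrow> 's \<Rightarrow> 's) \<Rightarrow> ('s \<times> 's) set" where
  "green_H S m = green_L S m \<inter> green_R S m"

text \<open>
  The join of two equivalence relations on \<open>S\<close> is the transitive closure of their union.
\<close>

definition green_D :: "'s set \<Rightarrow> ('s \<Rightarrow> 's \<Rightarrow> 's) \<Rightarrow> ('s \<times> 's) set" where
  "green_D S m = (green_L S m \<union> green_R S m)\<^sup>+"

definition regular_element :: "'s set \<Rightarrow> ('s \<Rightarrow> 's \<Rightarrow> 's) \<Rightarrow> 's \<Rightarrow> bool" where
  "regular_element S m x \<longleftrightarrow> x \<in> S \<and> (\<exists>y\<in>S. m (m x y) x = x)"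

end

theory Submission
  imports Defs
begin

text \<open>
  The proof separates semigroup theory from seeds.

  In any semigroup a regular element \<open>x = x z x\<close> lies in both \<open>S x\<close> and \<open>x S\<close>, so for regular
  elements Green's relations mean divisibility in both directions by honest elements of \<open>S\<close>.
  Moreover regularity spreads along \<open>\<L>\<close> and \<open>\<R>\<close>, hence over whole \<open>\<D>\<close>-classes.  This matters
  because \<open>\<D>\<close> is a transitive closure: the elements that link \<open>f\<close> to \<open>f'\<close> are arbitrary
  a priori.

  On the side of seeds, the composition is peculiar: a frozen variable of \<open>f\<close> survives in
  \<open>g \<circ> f\<close> only if its image is frozen in \<open>g\<close>.  So \<open>f = f \<circ> h \<circ> f\<close> forces \<open>f\<close> to send
  its exchangeable and its frozen variables to disjoint sets, which then are the exchangeable and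
  the frozen variables of the image seed (lemma \<open>regular_image\<close>), and \<open>f \<circ> h\<close> acts as the
  identity on that seed.

  Two regular elements with the same image therefore absorb each other's idempotent:
  \<open>f = (f' \<circ> h') \<circ> f = f' \<circ> (h' \<circ> f)\<close>.  Conversely a factorization \<open>f = f' \<circ> s\<close> only shrinks
  the image.  This is \<open>green_R_iff_same_image\<close>.  If \<open>f' = t \<circ> f\<close> and \<open>f = s \<circ> f'\<close>, then the sources agree,
  and \<open>t\<close> and \<open>s\<close> restrict to mutually inverse homomorphisms between the images; since a
  homomorphism never decreases \<open>\<bar>b\<^sub>x\<^sub>y\<bar>\<close>, both are isomorphisms (\<open>green_L_image_iso\<close>).
  Conversely the inverse of a seed isomorphism is a seed isomorphism, so composing \<open>f\<close> with an
  isomorphism defined on its image stays within the \<open>\<L>\<close>-class and can produce every isomorphic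
  image (\<open>iso_after_regular\<close>).  For \<open>\<D>\<close>, an isomorphism \<open>g\<close> from the image of \<open>f\<close> to that of \<open>f'\<close> gives
  \<open>f \<L> g \<circ> f \<R> f'\<close>.
\<close>

section \<open>Green's relations at regular elements\<close>

locale carrier_semigroup =
  fixes S :: "'s set" and m :: "'s \<Rightarrow> 's \<Rightarrow> 's"
  assumes closed: "a \<in> S \<Longrightarrow> b \<in> S \<Longrightarrow> m a b \<in> S"
    and assoc: "a \<in> S \<Longrightarrow> b \<in> S \<Longrightarrow> c \<in> S \<Longrightarrow> m (m a b) c = m a (m b c)"
begin

text \<open>
  The adjoined \<open>x\<close> in \<open>S x \<union> {x}\<close> only matters when \<open>x = y\<close>, and there \<open>x = (x z) x\<close> supplies
  a factorization inside \<open>S\<close>.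
\<close>

lemma green_L_iff_regular:
  assumes x: "regular_element S m x" and y: "y \<in> S"
  shows "(x, y) \<in> green_L S m \<longleftrightarrow> (\<exists>s\<in>S. \<exists>t\<in>S. x = m s y \<and> y = m t x)"
proof
  obtain z where z: "z \<in> S" "m (m x z) x = x" and xS: "x \<in> S"
    using x by (auto simp: regular_element_def)
  assume "(x, y) \<in> green_L S m"
  then have eq: "(\<lambda>s. m s x) ` S \<union> {x} = (\<lambda>s. m s y) ` S \<union> {y}"
    by (auto simp: green_L_def)
  show "\<exists>s\<in>S. \<exists>t\<in>S. x = m s y \<and> y = m t x"
  proof (cases "x = y")
    case True
    then show ?thesis using z xS closed by metis
  next
    case False
    have "x \<in> (\<lambda>s. m s y) ` S \<union> {y}" "y \<in> (\<lambda>s. m s x) ` S \<union> {x}" using eq by blast+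
    then show ?thesis using False by auto
  qed
next
  assume "\<exists>s\<in>S. \<exists>t\<in>S. x = m s y \<and> y = m t x"
  then obtain s t where st: "s \<in> S" "t \<in> S" "x = m s y" "y = m t x" by blast
  have xS: "x \<in> S" using x by (simp add: regular_element_def)
  have sub: "(\<lambda>u. m u a) ` S \<union> {a} \<subseteq> (\<lambda>u. m u b) ` S \<union> {b}"
    if "r \<in> S" "b \<in> S" "a = m r b" for a b r
  proof -
    have "m u a = m (m u r) b" if "u \<in> S" for u
      using that \<open>r \<in> S\<close> \<open>b \<in> S\<close> \<open>a = m r b\<close> assoc by simp
    then show ?thesis using that closed by blast
  qed
  show "(x, y) \<in> green_L S m"
    using sub[OF st(1) y st(3)] sub[OF st(2) xS st(4)] xS y by (auto simp: green_L_def)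
qed

lemma regular_green_L:
  assumes x: "regular_element S m x" and L: "(x, y) \<in> green_L S m"
  shows "regular_element S m y"
proof -
  have y: "y \<in> S" using L by (simp add: green_L_def)
  obtain s t where st: "s \<in> S" "t \<in> S" "x = m s y" "y = m t x"
    using green_L_iff_regular[OF x y] L by blast
  obtain z where z: "z \<in> S" "m (m x z) x = x" and xS: "x \<in> S"
    using x by (auto simp: regular_element_def)
  \<comment> \<open>\<open>y = t x = t x z x = y z x = y (z s) y\<close>\<close>
  have "y = m t (m (m x z) x)" using z(2) st(4) by simp
  also have "\<dots> = m (m (m t x) z) x" by (simp add: z(1) st(2) xS closed assoc)
  also have "\<dots> = m (m y z) (m s y)" by (simp only: st(3)[symmetric] st(4)[symmetric])
  also have "\<dots> = m (m y (m z s)) y" by (simp add: z(1) st(1) y closed assoc)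
  finally show ?thesis using y closed[OF z(1) st(1)] unfolding regular_element_def by metis
qed

text \<open>The statements about \<open>\<R>\<close> are those about \<open>\<L>\<close> in the opposite semigroup.\<close>

lemma opposite_semigroup: "carrier_semigroup S (\<lambda>a b. m b a)"
  by unfold_locales (auto simp: closed assoc)

lemma opposite_regular:
  "regular_element S (\<lambda>a b. m b a) x \<longleftrightarrow> regular_element S m x"
  using assoc by (auto simp: regular_element_def)

lemma opposite_green_L: "green_L S (\<lambda>a b. m b a) = green_R S m"
  by (simp add: green_L_def green_R_def)

lemma green_R_iff_regular:
  assumes "regular_element S m x" and "y \<in> S"
  shows "(x, y) \<in> green_R S m \<longleftrightarrow> (\<exists>s\<in>S. \<exists>t\<in>S. x = m y s \<and> y = m x t)"
  using carrier_semigroup.green_L_iff_regular[OF opposite_semigroup] assms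
  by (simp add: opposite_regular opposite_green_L)

lemma regular_green_R:
  assumes "regular_element S m x" and "(x, y) \<in> green_R S m"
  shows "regular_element S m y"
  using carrier_semigroup.regular_green_L[OF opposite_semigroup] assms
  unfolding opposite_regular opposite_green_L .

end


section \<open>Mixing-type sub-seeds and homomorphisms between them\<close>

lemma restrict_seed_sel [simp]:
  "exch (restrict_seed \<Sigma> E F) = E" "froz (restrict_seed \<Sigma> E F) = F"
  "ext (restrict_seed \<Sigma> E F) = E \<union> F"
  by (auto simp: restrict_seed_def ext_def)

text \<open>
  Sub-seeds are handled through their variables instead of the complementary pair
  \<open>I\<^sub>0, I\<^sub>1\<close>; \<open>mixing_iff\<close> translates.
\<close>

definition mixing :: "'a seed \<Rightarrow> 'a seed \<Rightarrow> bool" where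
  "mixing \<Sigma> T \<longleftrightarrow> exch T \<subseteq> exch \<Sigma> \<and> froz T \<subseteq> ext \<Sigma> \<and> exch T \<inter> froz T = {} \<and>
     T = restrict_seed \<Sigma> (exch T) (froz T)"

lemma mixing_restrict_seed:
  "E \<subseteq> exch \<Sigma> \<Longrightarrow> F \<subseteq> ext \<Sigma> \<Longrightarrow> E \<inter> F = {} \<Longrightarrow> mixing \<Sigma> (restrict_seed \<Sigma> E F)"
  by (simp add: mixing_def)

lemma mixing_iff:
  assumes "is_seed \<Sigma>"
  shows "mixing \<Sigma> T \<longleftrightarrow> (\<exists>I0 I1. mixing_pair \<Sigma> I0 I1 \<and> T = mixing_subseed \<Sigma> I0 I1)"
proof
  have disj: "exch \<Sigma> \<inter> froz \<Sigma> = {}" using assms by (simp add: is_seed_def)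
  assume T: "mixing \<Sigma> T"
  let ?I0 = "froz T \<inter> exch \<Sigma>" and ?I1 = "ext \<Sigma> - ext T"
  have "exch \<Sigma> - (?I0 \<union> ?I1) = exch T" "(froz \<Sigma> \<union> ?I0) - ?I1 = froz T"
    using T disj by (auto simp: mixing_def ext_def)
  then have "T = mixing_subseed \<Sigma> ?I0 ?I1"
    using T by (simp add: mixing_def mixing_subseed_def)
  moreover have "mixing_pair \<Sigma> ?I0 ?I1" by (auto simp: mixing_pair_def ext_def)
  ultimately show "\<exists>I0 I1. mixing_pair \<Sigma> I0 I1 \<and> T = mixing_subseed \<Sigma> I0 I1" by blast
next
  have disj: "exch \<Sigma> \<inter> froz \<Sigma> = {}" using assms by (simp add: is_seed_def)
  assume "\<exists>I0 I1. mixing_pair \<Sigma> I0 I1 \<and> T = mixing_subseed \<Sigma> I0 I1"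
  then obtain I0 I1 where "mixing_pair \<Sigma> I0 I1" and T: "T = mixing_subseed \<Sigma> I0 I1" by blast
  then show "mixing \<Sigma> T"
    unfolding T mixing_subseed_def
    by (intro mixing_restrict_seed) (use disj in \<open>auto simp: mixing_pair_def ext_def\<close>)
qed

lemma mixing_eqI:
  "mixing \<Sigma> T \<Longrightarrow> mixing \<Sigma> T' \<Longrightarrow> exch T = exch T' \<Longrightarrow> froz T = froz T' \<Longrightarrow> T = T'"
  unfolding mixing_def by metis

lemma mixing_self:
  assumes "is_seed \<Sigma>"
  shows "mixing \<Sigma> \<Sigma>"
proof -
  have "entry \<Sigma> = (\<lambda>x y. if x \<in> exch \<Sigma> \<and> y \<in> exch \<Sigma> \<union> froz \<Sigma> then entry \<Sigma> x y else 0)"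
    using assms by (auto simp: is_seed_def ext_def fun_eq_iff)
  then show ?thesis
    using assms by (auto simp: mixing_def restrict_seed_def is_seed_def ext_def)
qed

lemma entry_mixing:
  assumes "mixing \<Sigma> T" "x \<in> exch T" "y \<in> ext T"
  shows "entry T x y = entry \<Sigma> x y"
proof -
  have "entry T = entry (restrict_seed \<Sigma> (exch T) (froz T))"
    using assms(1) by (simp add: mixing_def)
  then show ?thesis using assms(2,3) by (simp add: restrict_seed_def ext_def)
qed

lemma exch_subset_ext: "exch T \<subseteq> ext T"
  by (auto simp: ext_def)

lemma seed_homD:
  assumes "seed_hom T T' f"
  shows "f ` ext T \<subseteq> ext T'" and "f ` exch T \<subseteq> exch T'"
    and "adjacent T (x, y) (z, w) \<Longrightarrow>
      0 \<le> (entry T' (f x) (f y) * entry T x y) * (entry T' (f z) (f w) * entry T z w)"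
    and "adjacent T (x, y) (z, w) \<Longrightarrow> \<bar>entry T x y\<bar> \<le> \<bar>entry T' (f x) (f y)\<bar>"
  using assms unfolding seed_hom_def by metis+

lemma seed_homI:
  assumes "f ` ext T \<subseteq> ext T'" and "f ` exch T \<subseteq> exch T'"
    and "\<And>x y z w. adjacent T (x, y) (z, w) \<Longrightarrow>
      0 \<le> (entry T' (f x) (f y) * entry T x y) * (entry T' (f z) (f w) * entry T z w)"
    and "\<And>x y z w. adjacent T (x, y) (z, w) \<Longrightarrow> \<bar>entry T x y\<bar> \<le> \<bar>entry T' (f x) (f y)\<bar>"
  shows "seed_hom T T' f"
  unfolding seed_hom_def using assms by metis

lemma adjacent_iff:
  "adjacent T (x, y) (z, w) \<longleftrightarrow> x \<in> exch T \<and> y \<in> ext T \<and> z \<in> exch T \<and> w \<in> ext T \<and>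
    (entry T x z \<noteq> 0 \<or> x = z)"
  by (simp add: adjacent_def)

text \<open>
  All sub-seeds share the entries of \<open>\<Sigma>\<close>, so their homomorphisms are governed by one condition on
  \<open>\<Sigma>\<close>.  Only the sets of variables remain, which makes restriction of source and
  target immediate.
\<close>

lemma seed_hom_mixing_iff:
  assumes T: "mixing \<Sigma> T" and T': "mixing \<Sigma> T'"
  shows "seed_hom T T' f \<longleftrightarrow> f ` ext T \<subseteq> ext T' \<and> f ` exch T \<subseteq> exch T' \<and>
    (\<forall>x\<in>exch T. \<forall>y\<in>ext T. \<forall>z\<in>exch T. \<forall>w\<in>ext T. entry \<Sigma> x z \<noteq> 0 \<or> x = z \<longrightarrow>
        (entry \<Sigma> (f x) (f y) * entry \<Sigma> x y) * (entry \<Sigma> (f z) (f w) * entry \<Sigma> z w) \<ge> 0 \<and>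
        \<bar>entry \<Sigma> (f x) (f y)\<bar> \<ge> \<bar>entry \<Sigma> x y\<bar>)"
  (is "_ \<longleftrightarrow> ?ext \<and> ?exch \<and> ?C")
proof -
  have "(\<forall>x y z w. adjacent T (x, y) (z, w) \<longrightarrow>
      (entry T' (f x) (f y) * entry T x y) * (entry T' (f z) (f w) * entry T z w) \<ge> 0 \<and>
      \<bar>entry T' (f x) (f y)\<bar> \<ge> \<bar>entry T x y\<bar>) \<longleftrightarrow> ?C" (is "?A \<longleftrightarrow> _") if ?ext ?exch
  proof -
    have e: "entry T x y = entry \<Sigma> x y" "entry T' (f x) (f y) = entry \<Sigma> (f x) (f y)"
      if "x \<in> exch T" "y \<in> ext T" for x y
      using that \<open>?ext\<close> \<open>?exch\<close> by (auto intro!: entry_mixing[OF T] entry_mixing[OF T'])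
    have a: "adjacent T (x, y) (z, w) \<longleftrightarrow> x \<in> exch T \<and> y \<in> ext T \<and> z \<in> exch T \<and> w \<in> ext T \<and>
        (entry \<Sigma> x z \<noteq> 0 \<or> x = z)" for x y z w
      using exch_subset_ext[of T] by (auto simp: adjacent_def e)
    show ?thesis
    proof (intro iffI allI ballI impI)
      fix x y z w
      assume A: ?A and mem: "x \<in> exch T" "y \<in> ext T" "z \<in> exch T" "w \<in> ext T"
        and "entry \<Sigma> x z \<noteq> 0 \<or> x = z"
      then have "adjacent T (x, y) (z, w)" unfolding a by blast
      then show "(entry \<Sigma> (f x) (f y) * entry \<Sigma> x y) * (entry \<Sigma> (f z) (f w) * entry \<Sigma> z w) \<ge> 0 \<and>
          \<bar>entry \<Sigma> (f x) (f y)\<bar> \<ge> \<bar>entry \<Sigma> x y\<bar>"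
        using A unfolding e[OF mem(1,2), symmetric] e[OF mem(3,4), symmetric] by blast
    next
      fix x y z w
      assume C: ?C and "adjacent T (x, y) (z, w)"
      then have mem: "x \<in> exch T" "y \<in> ext T" "z \<in> exch T" "w \<in> ext T"
        and "entry \<Sigma> x z \<noteq> 0 \<or> x = z" unfolding a by blast+
      then show "(entry T' (f x) (f y) * entry T x y) * (entry T' (f z) (f w) * entry T z w) \<ge> 0 \<and>
          \<bar>entry T' (f x) (f y)\<bar> \<ge> \<bar>entry T x y\<bar>"
        using C unfolding e[OF mem(1,2)] e[OF mem(3,4)] by blast
    qed
  qed
  then show ?thesis unfolding seed_hom_def by argo
qed

lemma seed_hom_between:
  assumes "mixing \<Sigma> T" "mixing \<Sigma> T'" "mixing \<Sigma> U" "mixing \<Sigma> U'"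
    and "seed_hom T T' f"
    and "exch U \<subseteq> exch T" "ext U \<subseteq> ext T" "f ` exch U \<subseteq> exch U'" "f ` ext U \<subseteq> ext U'"
  shows "seed_hom U U' f"
proof -
  note hom = assms(5)[unfolded seed_hom_mixing_iff[OF assms(1,2)]]
  show ?thesis unfolding seed_hom_mixing_iff[OF assms(3,4)]
  proof (intro conjI[OF assms(9)] conjI[OF assms(8)] ballI)
    fix x y z w
    assume "x \<in> exch U" "y \<in> ext U" "z \<in> exch U" "w \<in> ext U"
    then have "x \<in> exch T" "y \<in> ext T" "z \<in> exch T" "w \<in> ext T" using assms(6,7) by blast+
    then show "entry \<Sigma> x z \<noteq> 0 \<or> x = z \<longrightarrow>
        (entry \<Sigma> (f x) (f y) * entry \<Sigma> x y) * (entry \<Sigma> (f z) (f w) * entry \<Sigma> z w) \<ge> 0 \<and>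
        \<bar>entry \<Sigma> (f x) (f y)\<bar> \<ge> \<bar>entry \<Sigma> x y\<bar>"
      using hom by blast
  qed
qed

lemma seed_hom_cong:
  assumes eq: "\<And>x. x \<in> ext T \<Longrightarrow> f x = g x" and f: "seed_hom T T' f"
  shows "seed_hom T T' g"
proof -
  have eq': "f x = g x" if "x \<in> exch T" for x using that by (intro eq subsetD[OF exch_subset_ext])
  have im: "f ` ext T = g ` ext T" "f ` exch T = g ` exch T"
    by (rule image_cong[OF refl eq], assumption) (rule image_cong[OF refl eq'], assumption)
  show ?thesis
  proof (rule seed_homI)
    show "g ` ext T \<subseteq> ext T'" "g ` exch T \<subseteq> exch T'"
      using seed_homD(1,2)[OF f] unfolding im .
    fix x y z w
    assume a: "adjacent T (x, y) (z, w)"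
    then have mem: "x \<in> exch T" "y \<in> ext T" "z \<in> exch T" "w \<in> ext T"
      unfolding adjacent_iff by blast+
    note e = eq'[OF mem(1)] eq[OF mem(2)] eq'[OF mem(3)] eq[OF mem(4)]
    show "0 \<le> (entry T' (g x) (g y) * entry T x y) * (entry T' (g z) (g w) * entry T z w)"
      using seed_homD(3)[OF f a] unfolding e .
    show "\<bar>entry T x y\<bar> \<le> \<bar>entry T' (g x) (g y)\<bar>"
      using seed_homD(4)[OF f a] unfolding e .
  qed
qed

lemma seed_hom_abs_le:
  assumes "seed_hom T T' f" "x \<in> exch T" "y \<in> ext T"
  shows "\<bar>entry T x y\<bar> \<le> \<bar>entry T' (f x) (f y)\<bar>"
  using assms by (intro seed_homD(4)[of T T' f x y x y]) (simp_all add: adjacent_iff)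

text \<open>
  Homomorphisms compose because \<open>\<bar>b\<^sub>x\<^sub>z\<bar>\<close> never decreases: adjacent pairs stay adjacent and
  non-zero entries stay non-zero.  In the product of the two sign conditions the intermediate
  entries then occur squared and can be cancelled.
\<close>

lemma seed_hom_comp:
  assumes f: "seed_hom T T' f" and g: "seed_hom T' T'' g"
  shows "seed_hom T T'' (g \<circ> f)"
proof -
  note sub = seed_homD(1,2)[OF f] seed_homD(1,2)[OF g]
  have sign: "0 \<le> (c * a) * (c' * a')"
    if "0 \<le> (b * a) * (b' * a')" "0 \<le> (c * b) * (c' * b')" "\<bar>a\<bar> \<le> \<bar>b\<bar>" "\<bar>a'\<bar> \<le> \<bar>b'\<bar>"
    for a b c a' b' c' :: int
  proof (cases "a = 0 \<or> a' = 0")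
    case False
    then have nz: "b \<noteq> 0" "b' \<noteq> 0" using that by auto
    then have pos: "0 < (b * b') * (b * b')"
      using zero_less_power2[of "b * b'"] by (simp add: power2_eq_square)
    have "0 \<le> ((b * a) * (b' * a')) * ((c * b) * (c' * b'))" using that by simp
    also have "\<dots> = ((b * b') * (b * b')) * ((c * a) * (c' * a'))" by (simp add: algebra_simps)
    finally show ?thesis using pos by (simp add: zero_le_mult_iff)
  qed auto
  have key: "0 \<le> (entry T'' (g (f x)) (g (f y)) * entry T x y) * (entry T'' (g (f z)) (g (f w)) * entry T z w) \<and>
      \<bar>entry T x y\<bar> \<le> \<bar>entry T'' (g (f x)) (g (f y))\<bar>"
    if a: "adjacent T (x, y) (z, w)" for x y z w
  proof -
    have mem: "x \<in> exch T" "y \<in> ext T" "z \<in> exch T" "w \<in> ext T" "entry T x z \<noteq> 0 \<or> x = z"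
      using a unfolding adjacent_iff by blast+
    have "z \<in> ext T" using mem(3) exch_subset_ext by (rule subsetD[rotated])
    then have "\<bar>entry T x z\<bar> \<le> \<bar>entry T' (f x) (f z)\<bar>" using seed_hom_abs_le[OF f mem(1)] by simp
    then have a': "adjacent T' (f x, f y) (f z, f w)"
      unfolding adjacent_iff using mem sub(1,2) by auto
    have le: "\<bar>entry T x y\<bar> \<le> \<bar>entry T' (f x) (f y)\<bar>" "\<bar>entry T z w\<bar> \<le> \<bar>entry T' (f z) (f w)\<bar>"
      by (rule seed_hom_abs_le[OF f mem(1,2)], rule seed_hom_abs_le[OF f mem(3,4)])
    show ?thesis
      using sign[OF seed_homD(3)[OF f a] seed_homD(3)[OF g a'] le] le(1) seed_homD(4)[OF g a']
      by linarith
  qed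
  show ?thesis
  proof (rule seed_homI)
    show "(g \<circ> f) ` ext T \<subseteq> ext T''" using sub(1,3) by (auto simp: image_subset_iff)
    show "(g \<circ> f) ` exch T \<subseteq> exch T''" using sub(2,4) by (auto simp: image_subset_iff)
  qed (use key in simp_all)
qed

lemma seed_iso_refl: "seed_iso T T (\<lambda>x. x)"
proof -
  have "0 \<le> (a * a) * (b * b)" for a b :: int by (metis mult_nonneg_nonneg zero_le_square)
  then have "seed_hom T T (\<lambda>x. x)" by (intro seed_homI) simp_all
  then show ?thesis by (simp add: seed_iso_def bij_betw_def)
qed

lemma seed_iso_comp:
  assumes f: "seed_iso T T' f" and g: "seed_iso T' T'' g"
  shows "seed_iso T T'' (g \<circ> f)"
proof -
  have "f x \<in> exch T'" if "x \<in> exch T" for x using f that by (auto simp: seed_iso_def bij_betw_def)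
  moreover have "f x \<in> ext T'" if "x \<in> ext T" for x using f that by (auto simp: seed_iso_def bij_betw_def)
  ultimately show ?thesis using f g seed_hom_comp[of T T' f T'' g]
    unfolding seed_iso_def by (auto intro: bij_betw_trans)
qed

text \<open>The sign condition is symmetric in the two matrices, so it passes to the inverse map.\<close>

lemma seed_iso_inv:
  assumes g: "seed_iso T T' g"
  shows "seed_iso T' T (inv_into (ext T) g)"
proof -
  let ?h = "inv_into (ext T) g"
  have bij: "bij_betw g (exch T) (exch T')" "bij_betw g (ext T) (ext T')"
    and hom: "seed_hom T T' g"
    and abs: "\<And>x y. x \<in> exch T \<Longrightarrow> y \<in> ext T \<Longrightarrow> \<bar>entry T x y\<bar> = \<bar>entry T' (g x) (g y)\<bar>"
    using g by (auto simp: seed_iso_def)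
  have hg: "?h (g x) = x" if "x \<in> ext T" for x
    using bij(2) that by (simp add: bij_betw_def inv_into_f_f)
  have bh: "bij_betw ?h (ext T') (ext T)" using bij(2) by (rule bij_betw_inv_into)
  have ex: "\<exists>u\<in>exch T. u \<in> ext T \<and> x = g u" if "x \<in> exch T'" for x
  proof -
    have "x \<in> g ` exch T" using bij(1) that by (simp add: bij_betw_def)
    then show ?thesis using exch_subset_ext[of T] by blast
  qed
  have et: "\<exists>u\<in>ext T. x = g u" if "x \<in> ext T'" for x
    using bij(2) that by (auto simp: bij_betw_def)
  have "?h ` exch T' = exch T"
    using bij(1) hg exch_subset_ext[of T] by (force simp: bij_betw_def image_iff)
  then have bx: "bij_betw ?h (exch T') (exch T)"
    using bh exch_subset_ext[of T'] by (auto simp: bij_betw_def intro: inj_on_subset)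
  have abs': "\<bar>entry T' x y\<bar> = \<bar>entry T (?h x) (?h y)\<bar>" if xy: "x \<in> exch T'" "y \<in> ext T'" for x y
  proof -
    obtain u v where "u \<in> exch T" "u \<in> ext T" "x = g u" "v \<in> ext T" "y = g v"
      using ex[OF xy(1)] et[OF xy(2)] by blast
    then show ?thesis using abs hg by simp
  qed
  have "(entry T (?h x) (?h y) * entry T' x y) * (entry T (?h z) (?h w) * entry T' z w) \<ge> 0"
    if a: "adjacent T' (x, y) (z, w)" for x y z w
  proof -
    have m: "x \<in> exch T'" "y \<in> ext T'" "z \<in> exch T'" "w \<in> ext T'" "entry T' x z \<noteq> 0 \<or> x = z"
      using a by (auto simp: adjacent_def)
    obtain p q r s where *: "p \<in> exch T" "p \<in> ext T" "x = g p" "q \<in> ext T" "y = g q"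
      "r \<in> exch T" "r \<in> ext T" "z = g r" "s \<in> ext T" "w = g s"
      using ex[OF m(1)] et[OF m(2)] ex[OF m(3)] et[OF m(4)] by blast
    have "x = z \<Longrightarrow> p = r" using * hg by metis
    moreover have "entry T' x z \<noteq> 0 \<Longrightarrow> entry T p r \<noteq> 0"
      using abs[of p r] * by auto
    ultimately have "adjacent T (p, q) (r, s)" using m(5) * by (auto simp: adjacent_iff)
    from seed_homD(3)[OF hom this] show ?thesis using * hg by (simp add: mult.commute)
  qed
  moreover have "\<bar>entry T (?h x) (?h y)\<bar> \<ge> \<bar>entry T' x y\<bar>" if "adjacent T' (x, y) (z, w)" for x y z w
    using abs' that by (simp add: adjacent_def)
  ultimately have "seed_hom T' T ?h"
    using bh bx by (intro seed_homI) (simp_all add: bij_betw_def)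
  then show ?thesis using bh bx abs' by (simp add: seed_iso_def)
qed

lemma seed_iso_froz:
  assumes "seed_iso T T' g" "exch T \<inter> froz T = {}" "exch T' \<inter> froz T' = {}"
  shows "g ` froz T = froz T'"
proof -
  have b: "inj_on g (ext T)" "g ` ext T = ext T'" "g ` exch T = exch T'"
    using assms(1) by (auto simp: seed_iso_def bij_betw_def)
  have "froz T = ext T - exch T" "froz T' = ext T' - exch T'"
    using assms(2,3) by (auto simp: ext_def)
  then show ?thesis using b inj_on_image_set_diff[OF b(1), of "ext T" "exch T"] exch_subset_ext[of T]
    by simp
qed


section \<open>The semigroup of partial seed endomorphisms\<close>

lemma End_par_iff:
  assumes "is_seed \<Sigma>"
  shows "f \<in> End_par \<Sigma> \<longleftrightarrow> mixing \<Sigma> (source f) \<and> seed_hom (source f) \<Sigma> (fun_of f) \<and>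
    fun_of f \<in> extensional (ext (source f))"
  by (simp add: End_par_def mixing_iff[OF assms])

lemma source_par_comp [simp]:
  "exch (source (par_comp \<Sigma> g f)) = {x \<in> exch (source f). fun_of f x \<in> exch (source g)}"
  "froz (source (par_comp \<Sigma> g f)) = {x \<in> froz (source f). fun_of f x \<in> froz (source g)}"
  by (simp_all add: par_comp_def Let_def)

lemma fun_of_par_comp:
  "x \<in> ext (source (par_comp \<Sigma> g f)) \<Longrightarrow> fun_of (par_comp \<Sigma> g f) x = fun_of g (fun_of f x)"
  by (auto simp: par_comp_def Let_def compose_def)

lemma End_par_maps:
  assumes "f \<in> End_par \<Sigma>"
  shows "x \<in> exch (source f) \<Longrightarrow> fun_of f x \<in> exch \<Sigma>"
    and "x \<in> ext (source f) \<Longrightarrow> fun_of f x \<in> ext \<Sigma>"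
  using assms by (auto simp: End_par_def seed_hom_def)

lemma partial_hom_eqI:
  assumes "is_seed \<Sigma>" "f \<in> End_par \<Sigma>" "g \<in> End_par \<Sigma>"
    and "exch (source f) = exch (source g)" "froz (source f) = froz (source g)"
    and "\<And>x. x \<in> ext (source f) \<Longrightarrow> fun_of f x = fun_of g x"
  shows "f = g"
proof -
  have s: "source f = source g"
    by (rule mixing_eqI[of \<Sigma>]) (use assms(1-5) in \<open>simp_all add: End_par_iff\<close>)
  have "fun_of f = fun_of g"
    using assms s by (intro extensionalityI[of _ "ext (source f)"]) (simp_all add: End_par_iff)
  then show ?thesis using s by simp
qed

lemma par_comp_closed:
  assumes S: "is_seed \<Sigma>" and g: "g \<in> End_par \<Sigma>" and f: "f \<in> End_par \<Sigma>"
  shows "par_comp \<Sigma> g f \<in> End_par \<Sigma>"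
proof -
  let ?k = "par_comp \<Sigma> g f"
  have mf: "mixing \<Sigma> (source f)" and mg: "mixing \<Sigma> (source g)" using f g S by (auto simp: End_par_iff)
  have mk: "mixing \<Sigma> (source ?k)"
    unfolding par_comp_def Let_def using mf
    by (simp add: mixing_def) (auto simp: ext_def)
  have "seed_hom (source ?k) (source g) (fun_of f)"
    by (rule seed_hom_between[OF mf mixing_self[OF S] mk mg])
      (use f S in \<open>auto simp: ext_def End_par_iff\<close>)
  moreover have "seed_hom (source g) \<Sigma> (fun_of g)" using g S by (simp add: End_par_iff)
  ultimately have "seed_hom (source ?k) \<Sigma> (fun_of g \<circ> fun_of f)" by (rule seed_hom_comp)
  then have "seed_hom (source ?k) \<Sigma> (fun_of ?k)"
    by (rule seed_hom_cong[rotated]) (simp add: fun_of_par_comp)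
  then show ?thesis using mk S
    by (simp add: End_par_iff) (simp add: par_comp_def Let_def)
qed

lemma par_comp_assoc:
  assumes S: "is_seed \<Sigma>" and h: "h \<in> End_par \<Sigma>" and g: "g \<in> End_par \<Sigma>" and f: "f \<in> End_par \<Sigma>"
  shows "par_comp \<Sigma> (par_comp \<Sigma> h g) f = par_comp \<Sigma> h (par_comp \<Sigma> g f)"
proof (rule partial_hom_eqI[OF S])
  show "par_comp \<Sigma> (par_comp \<Sigma> h g) f \<in> End_par \<Sigma>" "par_comp \<Sigma> h (par_comp \<Sigma> g f) \<in> End_par \<Sigma>"
    using assms par_comp_closed by blast+
qed (auto simp: fun_of_par_comp ext_def)

lemma End_par_semigroup: "is_seed \<Sigma> \<Longrightarrow> carrier_semigroup (End_par \<Sigma>) (par_comp \<Sigma>)"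
  by unfold_locales (auto simp: par_comp_closed par_comp_assoc)

lemma par_comp_left_absorb:
  assumes S: "is_seed \<Sigma>" and e: "e \<in> End_par \<Sigma>" and f: "f \<in> End_par \<Sigma>"
    and "fun_of f ` exch (source f) \<subseteq> exch (source e)"
    and "fun_of f ` froz (source f) \<subseteq> froz (source e)"
    and "\<And>x. x \<in> ext (source f) \<Longrightarrow> fun_of e (fun_of f x) = fun_of f x"
  shows "par_comp \<Sigma> e f = f"
  by (rule partial_hom_eqI[OF S par_comp_closed[OF S e f] f])
    (use assms(4-) in \<open>auto simp: fun_of_par_comp ext_def\<close>)


section \<open>Image seeds of regular elements\<close>

abbreviation (input) image_of :: "'a seed \<Rightarrow> 'a partial_hom \<Rightarrow> 'a seed" where
  "image_of \<Sigma> f \<equiv> image_seed (fun_of f) (source f) \<Sigma>"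

abbreviation (input) regular_par :: "'a seed \<Rightarrow> 'a partial_hom \<Rightarrow> bool" where
  "regular_par \<Sigma> \<equiv> regular_element (End_par \<Sigma>) (par_comp \<Sigma>)"

lemma regular_idempotent:
  assumes S: "is_seed \<Sigma>" and f: "regular_par \<Sigma> f"
  obtains h where "h \<in> End_par \<Sigma>"
    and "fun_of f ` exch (source f) \<subseteq> exch (source (par_comp \<Sigma> f h))"
    and "fun_of f ` froz (source f) \<subseteq> froz (source (par_comp \<Sigma> f h))"
    and "\<And>x. x \<in> ext (source f) \<Longrightarrow> fun_of (par_comp \<Sigma> f h) (fun_of f x) = fun_of f x"
proof -
  obtain h where h: "h \<in> End_par \<Sigma>" and eq: "par_comp \<Sigma> (par_comp \<Sigma> f h) f = f"
    using f by (auto simp: regular_element_def)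
  let ?e = "par_comp \<Sigma> f h"
  have E: "exch (source f) = {x \<in> exch (source f). fun_of f x \<in> exch (source ?e)}"
    using source_par_comp(1)[of \<Sigma> ?e f] unfolding eq .
  have F: "froz (source f) = {x \<in> froz (source f). fun_of f x \<in> froz (source ?e)}"
    using source_par_comp(2)[of \<Sigma> ?e f] unfolding eq .
  have G: "fun_of ?e (fun_of f x) = fun_of f x" if "x \<in> ext (source f)" for x
    using fun_of_par_comp[of x \<Sigma> ?e f] that unfolding eq by simp
  show thesis
  proof (rule that[OF h _ _ G])
    show "fun_of f ` exch (source f) \<subseteq> exch (source ?e)" using E by blast
    show "fun_of f ` froz (source f) \<subseteq> froz (source ?e)" using F by blast
  qed
qed

text \<open>
  For a general homomorphism an exchangeable and a frozen variable may share their image, which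
  is then exchangeable in the image seed.  Regularity rules this out, because the image has to be
  exchangeable, respectively frozen, in the source of the idempotent \<open>f \<circ> h\<close>.
\<close>

lemma regular_image:
  assumes S: "is_seed \<Sigma>" and f: "regular_par \<Sigma> f"
  shows "exch (image_of \<Sigma> f) = fun_of f ` exch (source f)"
    and "froz (image_of \<Sigma> f) = fun_of f ` froz (source f)"
    and "mixing \<Sigma> (image_of \<Sigma> f)"
proof -
  have fE: "f \<in> End_par \<Sigma>" using f by (simp add: regular_element_def)
  obtain h where h: "h \<in> End_par \<Sigma>"
    and sub: "fun_of f ` exch (source f) \<subseteq> exch (source (par_comp \<Sigma> f h))"
      "fun_of f ` froz (source f) \<subseteq> froz (source (par_comp \<Sigma> f h))"
    using regular_idempotent[OF S f] by metis
  have "mixing \<Sigma> (source (par_comp \<Sigma> f h))"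
    using par_comp_closed[OF S fE h] S by (simp add: End_par_iff)
  then have disj: "fun_of f ` exch (source f) \<inter> fun_of f ` froz (source f) = {}"
    using sub unfolding mixing_def by blast
  show "exch (image_of \<Sigma> f) = fun_of f ` exch (source f)" by (simp add: image_seed_def)
  show "froz (image_of \<Sigma> f) = fun_of f ` froz (source f)"
    using disj by (auto simp: image_seed_def ext_def)
  show "mixing \<Sigma> (image_of \<Sigma> f)"
    unfolding image_seed_def
    by (rule mixing_restrict_seed) (use End_par_maps[OF fE] in auto)
qed

lemma image_par_comp_subset:
  assumes "f = par_comp \<Sigma> g s"
  shows "fun_of f ` exch (source f) \<subseteq> fun_of g ` exch (source g)"
    and "fun_of f ` froz (source f) \<subseteq> fun_of g ` froz (source g)"
proof -
  have "fun_of f x \<in> fun_of g ` exch (source g)" if "x \<in> exch (source f)" for x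
    using that fun_of_par_comp[of x \<Sigma> g s] unfolding assms by (auto simp: ext_def)
  moreover have "fun_of f x \<in> fun_of g ` froz (source g)" if "x \<in> froz (source f)" for x
    using that fun_of_par_comp[of x \<Sigma> g s] unfolding assms by (auto simp: ext_def)
  ultimately show "fun_of f ` exch (source f) \<subseteq> fun_of g ` exch (source g)"
    "fun_of f ` froz (source f) \<subseteq> fun_of g ` froz (source g)" by blast+
qed

text \<open>
  Since \<open>f'\<close> is regular, some \<open>f' \<circ> h\<close> is the identity on the image of \<open>f'\<close>, which is also
  the image of \<open>f\<close>; so \<open>f = (f' \<circ> h) \<circ> f\<close>, and \<open>h \<circ> f\<close> is the required factor.
\<close>

lemma factor_through_same_image:
  assumes S: "is_seed \<Sigma>" and f: "regular_par \<Sigma> f" and f': "regular_par \<Sigma> f'"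
    and im: "image_of \<Sigma> f = image_of \<Sigma> f'"
  shows "\<exists>s\<in>End_par \<Sigma>. f = par_comp \<Sigma> f' s"
proof -
  have E: "f \<in> End_par \<Sigma>" "f' \<in> End_par \<Sigma>" using f f' by (auto simp: regular_element_def)
  have ims: "fun_of f ` exch (source f) = fun_of f' ` exch (source f')"
    "fun_of f ` froz (source f) = fun_of f' ` froz (source f')"
    using regular_image[OF S f] regular_image[OF S f'] im by metis+
  obtain h where h: "h \<in> End_par \<Sigma>"
    and sub: "fun_of f' ` exch (source f') \<subseteq> exch (source (par_comp \<Sigma> f' h))"
      "fun_of f' ` froz (source f') \<subseteq> froz (source (par_comp \<Sigma> f' h))"
    and id: "\<And>x. x \<in> ext (source f') \<Longrightarrow> fun_of (par_comp \<Sigma> f' h) (fun_of f' x) = fun_of f' x"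
    using regular_idempotent[OF S f'] by metis
  have "fun_of (par_comp \<Sigma> f' h) (fun_of f x) = fun_of f x" if "x \<in> ext (source f)" for x
  proof -
    have "fun_of f x \<in> fun_of f' ` ext (source f')"
      using that ims unfolding ext_def image_Un by blast
    then obtain y where "y \<in> ext (source f')" "fun_of f x = fun_of f' y" by blast
    then show ?thesis using id[of y] by simp
  qed
  then have "par_comp \<Sigma> (par_comp \<Sigma> f' h) f = f"
    using sub unfolding ims[symmetric]
    by (intro par_comp_left_absorb[OF S par_comp_closed[OF S E(2) h] E(1)])
  then have "f = par_comp \<Sigma> f' (par_comp \<Sigma> h f)" using par_comp_assoc[OF S E(2) h E(1)] by simp
  then show ?thesis using par_comp_closed[OF S h E(1)] by blast
qed

lemma green_R_iff_same_image:
  assumes S: "is_seed \<Sigma>" and f: "regular_par \<Sigma> f" and f': "regular_par \<Sigma> f'"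
  shows "(f, f') \<in> green_R (End_par \<Sigma>) (par_comp \<Sigma>) \<longleftrightarrow> image_of \<Sigma> f = image_of \<Sigma> f'"
proof -
  interpret carrier_semigroup "End_par \<Sigma>" "par_comp \<Sigma>" by (rule End_par_semigroup[OF S])
  have E: "f' \<in> End_par \<Sigma>" using f' by (auto simp: regular_element_def)
  show ?thesis
    unfolding green_R_iff_regular[OF f E]
  proof
    assume "\<exists>s\<in>End_par \<Sigma>. \<exists>t\<in>End_par \<Sigma>. f = par_comp \<Sigma> f' s \<and> f' = par_comp \<Sigma> f t"
    then obtain s t where fs: "f = par_comp \<Sigma> f' s" and ft: "f' = par_comp \<Sigma> f t" by blast
    have "fun_of f ` exch (source f) = fun_of f' ` exch (source f')"
      "fun_of f ` froz (source f) = fun_of f' ` froz (source f')"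
      by (intro antisym image_par_comp_subset[OF fs] image_par_comp_subset[OF ft])+
    then show "image_of \<Sigma> f = image_of \<Sigma> f'"
      using regular_image[OF S f] regular_image[OF S f']
      by (intro mixing_eqI[of \<Sigma>]) simp_all
  next
    assume im: "image_of \<Sigma> f = image_of \<Sigma> f'"
    show "\<exists>s\<in>End_par \<Sigma>. \<exists>t\<in>End_par \<Sigma>. f = par_comp \<Sigma> f' s \<and> f' = par_comp \<Sigma> f t"
      using factor_through_same_image[OF S f f' im] factor_through_same_image[OF S f' f im[symmetric]]
      by blast
  qed
qed


section \<open>Composition with seed isomorphisms\<close>

definition restricted_hom :: "'a seed \<Rightarrow> ('a \<Rightarrow> 'a) \<Rightarrow> 'a partial_hom" where
  "restricted_hom T g = \<lparr>source = T, fun_of = restrict g (ext T)\<rparr>"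

text \<open>
  With an identity inclusion in front, \<open>comp_hom\<close> merely enlarges the target to all of
  \<open>\<Sigma>\<close>, and the pair describing the target drops out.
\<close>

lemma comp_hom_id_par:
  assumes "g ` ext T \<subseteq> ext (mixing_subseed \<Sigma> I0 I1)"
  shows "comp_hom (id_par \<Sigma> I0 I1) g T = restricted_hom T g"
proof -
  have "g x \<in> ext (mixing_subseed \<Sigma> I0 I1)" if "x \<in> ext T" for x using assms that by blast
  then have "compose (ext T) (fun_of (id_par \<Sigma> I0 I1)) g = restrict g (ext T)"
    by (simp add: id_par_def compose_def restrict_def fun_eq_iff)
  then show ?thesis by (simp add: comp_hom_def restricted_hom_def)
qed

lemma restricted_hom_End_par:
  assumes S: "is_seed \<Sigma>" and T: "mixing \<Sigma> T" and T': "mixing \<Sigma> T'" and g: "seed_hom T T' g"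
  shows "restricted_hom T g \<in> End_par \<Sigma>"
proof -
  have "g ` exch T \<subseteq> exch \<Sigma>" "g ` ext T \<subseteq> ext \<Sigma>"
    using seed_homD(1,2)[OF g] T' unfolding mixing_def ext_def by blast+
  then have "seed_hom T \<Sigma> g"
    by (intro seed_hom_between[OF T T' T mixing_self[OF S] g] order_refl)
  then have "seed_hom T \<Sigma> (restrict g (ext T))" by (rule seed_hom_cong[rotated]) simp
  then show ?thesis using S T by (simp add: End_par_iff restricted_hom_def)
qed

text \<open>
  For regular \<open>f\<close> the image seed is itself a source of partial endomorphisms whose exchangeable
  and frozen parts are hit exactly by those of \<open>f\<close>.  Hence composing with \<open>g\<close> loses no variable
  of \<open>f\<close>, and composing with the inverse of \<open>g\<close> undoes it.
\<close>

lemma iso_after_regular: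
  assumes S: "is_seed \<Sigma>" and f: "regular_par \<Sigma> f" and T: "mixing \<Sigma> T"
    and g: "seed_iso (image_of \<Sigma> f) T g"
  defines "k \<equiv> par_comp \<Sigma> (restricted_hom (image_of \<Sigma> f) g) f"
  shows "(f, k) \<in> green_L (End_par \<Sigma>) (par_comp \<Sigma>)" and "image_of \<Sigma> k = T"
proof -
  interpret carrier_semigroup "End_par \<Sigma>" "par_comp \<Sigma>" by (rule End_par_semigroup[OF S])
  note im = regular_image[OF S f]
  let ?t = "restricted_hom (image_of \<Sigma> f) g"
  let ?s = "restricted_hom T (inv_into (ext (image_of \<Sigma> f)) g)"
  have fE: "f \<in> End_par \<Sigma>" using f by (simp add: regular_element_def)
  have tE: "?t \<in> End_par \<Sigma>"
    using g by (intro restricted_hom_End_par[OF S im(3) T]) (simp add: seed_iso_def)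
  have sE: "?s \<in> End_par \<Sigma>"
    using seed_iso_inv[OF g] by (intro restricted_hom_End_par[OF S T im(3)]) (simp add: seed_iso_def)
  have kE: "k \<in> End_par \<Sigma>" unfolding k_def using tE fE by (rule closed)
  have gE: "g ` exch (image_of \<Sigma> f) = exch T" "inj_on g (ext (image_of \<Sigma> f))"
    using g by (auto simp: seed_iso_def bij_betw_def)
  have gF: "g ` froz (image_of \<Sigma> f) = froz T"
    using seed_iso_froz[OF g] im(3) T by (auto simp: mixing_def)
  have src: "exch (source k) = exch (source f)" "froz (source k) = froz (source f)"
    using im unfolding k_def by (auto simp: restricted_hom_def)
  have inim: "fun_of f x \<in> ext (image_of \<Sigma> f)" if "x \<in> ext (source f)" for x
    using that im by (auto simp: ext_def)
  have app: "fun_of k x = g (fun_of f x)" if "x \<in> ext (source f)" for x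
  proof -
    have "x \<in> ext (source k)" using that src by (simp add: ext_def)
    then show ?thesis using fun_of_par_comp[of x \<Sigma> ?t f] inim[OF that]
      by (simp add: k_def restricted_hom_def)
  qed
  have imE: "fun_of k ` exch (source k) = exch T"
  proof -
    have "fun_of k ` exch (source k) = g ` fun_of f ` exch (source f)"
      unfolding src image_image using app by (intro image_cong) (auto simp: ext_def)
    then show ?thesis using gE im by simp
  qed
  have imF: "fun_of k ` froz (source k) = froz T"
  proof -
    have "fun_of k ` froz (source k) = g ` fun_of f ` froz (source f)"
      unfolding src image_image using app by (intro image_cong) (auto simp: ext_def)
    then show ?thesis using gF im by simp
  qed
  have "f = par_comp \<Sigma> ?s k"
  proof (rule partial_hom_eqI[OF S fE closed[OF sE kE]])
    show E: "exch (source f) = exch (source (par_comp \<Sigma> ?s k))"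
      using imE src by (auto simp: restricted_hom_def)
    show F: "froz (source f) = froz (source (par_comp \<Sigma> ?s k))"
      using imF src by (auto simp: restricted_hom_def)
    fix x assume x: "x \<in> ext (source f)"
    then have x2: "x \<in> ext (source (par_comp \<Sigma> ?s k))" using E F by (simp add: ext_def)
    have "fun_of k x \<in> ext T" using x imE imF src by (auto simp: ext_def)
    then show "fun_of f x = fun_of (par_comp \<Sigma> ?s k) x"
      unfolding fun_of_par_comp[OF x2] using app[OF x] inim[OF x] gE(2)
      by (simp add: restricted_hom_def)
  qed
  then show L: "(f, k) \<in> green_L (End_par \<Sigma>) (par_comp \<Sigma>)"
    using green_L_iff_regular[OF f kE] sE tE k_def by blast
  have "regular_par \<Sigma> k" using regular_green_L[OF f L] .
  from regular_image[OF S this] show "image_of \<Sigma> k = T"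
    using imE imF T by (intro mixing_eqI[of \<Sigma>]) simp_all
qed

text \<open>
  With \<open>f' = t \<circ> f\<close> and \<open>f = s \<circ> f'\<close>, the map \<open>t\<close> itself, restricted to the image of \<open>f\<close>, is
  the isomorphism; \<open>s\<close> is its inverse there and provides the reverse inequality between the
  absolute values of the entries.
\<close>

lemma green_L_image_iso:
  assumes S: "is_seed \<Sigma>" and f: "regular_par \<Sigma> f"
    and L: "(f, f') \<in> green_L (End_par \<Sigma>) (par_comp \<Sigma>)"
  shows "source f = source f'"
    and "\<exists>g. seed_iso (image_of \<Sigma> f) (image_of \<Sigma> f') g \<and>
             f' = par_comp \<Sigma> (restricted_hom (image_of \<Sigma> f) g) f"
proof -
  interpret carrier_semigroup "End_par \<Sigma>" "par_comp \<Sigma>" by (rule End_par_semigroup[OF S])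
  have f': "regular_par \<Sigma> f'" using regular_green_L[OF f L] .
  have E: "f \<in> End_par \<Sigma>" "f' \<in> End_par \<Sigma>" using f f' by (auto simp: regular_element_def)
  obtain s t where st: "s \<in> End_par \<Sigma>" "t \<in> End_par \<Sigma>"
    and fs: "f = par_comp \<Sigma> s f'" and ft: "f' = par_comp \<Sigma> t f"
    using green_L_iff_regular[OF f E(2)] L by blast
  note im = regular_image[OF S f] and im' = regular_image[OF S f']
  have xf: "exch (source f) = {x \<in> exch (source f'). fun_of f' x \<in> exch (source s)}"
    "froz (source f) = {x \<in> froz (source f'). fun_of f' x \<in> froz (source s)}"
    using source_par_comp[of \<Sigma> s f'] unfolding fs[symmetric] by blast+
  have xf': "exch (source f') = {x \<in> exch (source f). fun_of f x \<in> exch (source t)}"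
    "froz (source f') = {x \<in> froz (source f). fun_of f x \<in> froz (source t)}"
    using source_par_comp[of \<Sigma> t f] unfolding ft[symmetric] by blast+
  have xe: "exch (source f) = exch (source f')" "froz (source f) = froz (source f')"
    using xf xf' by blast+
  then show src: "source f = source f'"
    using E S by (intro mixing_eqI[of \<Sigma>]) (simp_all add: End_par_iff)
  have t_im: "exch (image_of \<Sigma> f) \<subseteq> exch (source t)" "froz (image_of \<Sigma> f) \<subseteq> froz (source t)"
    using xf'[folded xe] unfolding im(1,2) by blast+
  have s_im: "exch (image_of \<Sigma> f') \<subseteq> exch (source s)" "froz (image_of \<Sigma> f') \<subseteq> froz (source s)"
    using xf[unfolded xe] unfolding im'(1,2) by blast+
  have tf: "fun_of t (fun_of f x) = fun_of f' x" if "x \<in> ext (source f)" for x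
    using fun_of_par_comp[of x \<Sigma> t f] that unfolding ft[symmetric] src by simp
  have sf: "fun_of s (fun_of f' x) = fun_of f x" if "x \<in> ext (source f)" for x
    using fun_of_par_comp[of x \<Sigma> s f'] that unfolding fs[symmetric] src by simp
  have iext: "ext (image_of \<Sigma> f) = fun_of f ` ext (source f)"
    "ext (image_of \<Sigma> f') = fun_of f' ` ext (source f)"
    using im im' src by (simp_all add: ext_def image_Un)
  have t_exch: "fun_of t ` exch (image_of \<Sigma> f) = exch (image_of \<Sigma> f')"
    unfolding im(1) im'(1) image_image xe[symmetric]
    using tf by (intro image_cong) (auto simp: ext_def)
  have t_ext: "fun_of t ` ext (image_of \<Sigma> f) = ext (image_of \<Sigma> f')"
    unfolding iext image_image using tf by (intro image_cong) auto
  have s_exch: "fun_of s ` exch (image_of \<Sigma> f') = exch (image_of \<Sigma> f)"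
    unfolding im(1) im'(1) image_image xe[symmetric]
    using sf by (intro image_cong) (auto simp: ext_def)
  have s_ext: "fun_of s ` ext (image_of \<Sigma> f') = ext (image_of \<Sigma> f)"
    unfolding iext image_image using sf by (intro image_cong) auto
  have st_id: "fun_of s (fun_of t y) = y" if "y \<in> ext (image_of \<Sigma> f)" for y
    using that tf sf unfolding iext by auto
  have inj: "inj_on (fun_of t) (ext (image_of \<Sigma> f))" using st_id by (metis inj_onI)
  have hom_t: "seed_hom (image_of \<Sigma> f) (image_of \<Sigma> f') (fun_of t)"
    by (rule seed_hom_between[of \<Sigma> "source t" \<Sigma>])
      (use st S t_im im(3) im'(3) t_exch t_ext mixing_self[OF S] in \<open>auto simp: End_par_iff ext_def\<close>)
  have hom_s: "seed_hom (image_of \<Sigma> f') (image_of \<Sigma> f) (fun_of s)"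
    by (rule seed_hom_between[of \<Sigma> "source s" \<Sigma>])
      (use st S s_im im(3) im'(3) s_exch s_ext mixing_self[OF S] in \<open>auto simp: End_par_iff ext_def\<close>)
  have abs: "\<bar>entry (image_of \<Sigma> f) x y\<bar> = \<bar>entry (image_of \<Sigma> f') (fun_of t x) (fun_of t y)\<bar>"
    if xy: "x \<in> exch (image_of \<Sigma> f)" "y \<in> ext (image_of \<Sigma> f)" for x y
  proof (rule antisym)
    show "\<bar>entry (image_of \<Sigma> f) x y\<bar> \<le> \<bar>entry (image_of \<Sigma> f') (fun_of t x) (fun_of t y)\<bar>"
      using seed_hom_abs_le[OF hom_t xy] .
    have "fun_of t x \<in> exch (image_of \<Sigma> f')" "fun_of t y \<in> ext (image_of \<Sigma> f')"
      using xy t_exch t_ext by blast+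
    from seed_hom_abs_le[OF hom_s this]
    show "\<bar>entry (image_of \<Sigma> f') (fun_of t x) (fun_of t y)\<bar> \<le> \<bar>entry (image_of \<Sigma> f) x y\<bar>"
      using st_id xy exch_subset_ext by (metis subsetD)
  qed
  have iso: "seed_iso (image_of \<Sigma> f) (image_of \<Sigma> f') (fun_of t)"
    unfolding seed_iso_def bij_betw_def
    using hom_t inj inj_on_subset[OF inj exch_subset_ext] t_exch t_ext abs by blast
  have tE: "restricted_hom (image_of \<Sigma> f) (fun_of t) \<in> End_par \<Sigma>"
    using restricted_hom_End_par[OF S im(3) im'(3) hom_t] .
  have "f' = par_comp \<Sigma> (restricted_hom (image_of \<Sigma> f) (fun_of t)) f" (is "_ = ?k")
  proof (rule partial_hom_eqI[OF S E(2) closed[OF tE E(1)]])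
    show X: "exch (source f') = exch (source ?k)" "froz (source f') = froz (source ?k)"
      using im xe by (auto simp: restricted_hom_def)
    fix x assume x: "x \<in> ext (source f')"
    then have "x \<in> ext (source ?k)" using X by (simp add: ext_def)
    then show "fun_of f' x = fun_of ?k x"
      using x src tf iext by (simp add: fun_of_par_comp restricted_hom_def)
  qed
  then show "\<exists>g. seed_iso (image_of \<Sigma> f) (image_of \<Sigma> f') g \<and>
      f' = par_comp \<Sigma> (restricted_hom (image_of \<Sigma> f) g) f"
    using iso by blast
qed

text \<open>
  Each link of a chain from \<open>f\<close> to \<open>f'\<close> preserves both regularity and the isomorphism type
  of the image.  The former is what allows the latter to be applied to the next link.
\<close>

lemma green_D_iff_isomorphic:
  assumes S: "is_seed \<Sigma>" and f: "regular_par \<Sigma> f" and f': "regular_par \<Sigma> f'"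
  shows "(f, f') \<in> green_D (End_par \<Sigma>) (par_comp \<Sigma>) \<longleftrightarrow>
    isomorphic_seeds (image_of \<Sigma> f) (image_of \<Sigma> f')"
proof
  interpret carrier_semigroup "End_par \<Sigma>" "par_comp \<Sigma>" by (rule End_par_semigroup[OF S])
  have link: "regular_par \<Sigma> y \<and> isomorphic_seeds (image_of \<Sigma> x) (image_of \<Sigma> y)"
    if x: "regular_par \<Sigma> x"
      and xy: "(x, y) \<in> green_L (End_par \<Sigma>) (par_comp \<Sigma>) \<union> green_R (End_par \<Sigma>) (par_comp \<Sigma>)" for x y
  proof (cases "(x, y) \<in> green_L (End_par \<Sigma>) (par_comp \<Sigma>)")
    case True
    then show ?thesis
      using regular_green_L[OF x] green_L_image_iso(2)[OF S x] by (auto simp: isomorphic_seeds_def)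
  next
    case False
    then have R: "(x, y) \<in> green_R (End_par \<Sigma>) (par_comp \<Sigma>)" using xy by blast
    then have y: "regular_par \<Sigma> y" using regular_green_R[OF x] by blast
    have "image_of \<Sigma> x = image_of \<Sigma> y" using green_R_iff_same_image[OF S x y] R by blast
    then show ?thesis using y seed_iso_refl isomorphic_seeds_def by metis
  qed
  assume "(f, f') \<in> green_D (End_par \<Sigma>) (par_comp \<Sigma>)"
  then have "regular_par \<Sigma> f' \<and> isomorphic_seeds (image_of \<Sigma> f) (image_of \<Sigma> f')"
    unfolding green_D_def
  proof (induction rule: trancl_induct)
    case (base y)
    then show ?case using link[OF f] by blast
  next
    case (step y z)
    then have "regular_par \<Sigma> z" "isomorphic_seeds (image_of \<Sigma> y) (image_of \<Sigma> z)"
      using link[of y z] by blast+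
    then show ?case using step.IH seed_iso_comp unfolding isomorphic_seeds_def by blast
  qed
  then show "isomorphic_seeds (image_of \<Sigma> f) (image_of \<Sigma> f')" by blast
next
  interpret carrier_semigroup "End_par \<Sigma>" "par_comp \<Sigma>" by (rule End_par_semigroup[OF S])
  assume "isomorphic_seeds (image_of \<Sigma> f) (image_of \<Sigma> f')"
  then obtain g where g: "seed_iso (image_of \<Sigma> f) (image_of \<Sigma> f') g"
    by (auto simp: isomorphic_seeds_def)
  define k where "k = par_comp \<Sigma> (restricted_hom (image_of \<Sigma> f) g) f"
  have k: "(f, k) \<in> green_L (End_par \<Sigma>) (par_comp \<Sigma>)" "image_of \<Sigma> k = image_of \<Sigma> f'"
    using iso_after_regular[OF S f regular_image(3)[OF S f'] g] by (simp_all add: k_def)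
  have "(k, f') \<in> green_R (End_par \<Sigma>) (par_comp \<Sigma>)"
    using green_R_iff_same_image[OF S regular_green_L[OF f k(1)] f'] k(2) by blast
  then show "(f, f') \<in> green_D (End_par \<Sigma>) (par_comp \<Sigma>)"
    unfolding green_D_def using k(1) by (meson UnI1 UnI2 r_into_trancl trancl_into_trancl)
qed


section \<open>Green's relations on regular partial endomorphisms\<close>

theorem theorem1p1:
  fixes \<Sigma> :: "'a::field_char_0 seed"
    and f f' :: "'a partial_hom"
    and I0 I1 I0' I1' :: "'a set"
  assumes "is_seed \<Sigma>"
    and "mixing_pair \<Sigma> I0 I1" and "source f = mixing_subseed \<Sigma> I0 I1"
    and "mixing_pair \<Sigma> I0' I1'" and "source f' = mixing_subseed \<Sigma> I0' I1'"
    and "regular_element (End_par \<Sigma>) (par_comp \<Sigma>) f"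
    and "regular_element (End_par \<Sigma>) (par_comp \<Sigma>) f'"
  shows
   "let im = image_seed (fun_of f) (mixing_subseed \<Sigma> I0 I1) \<Sigma>;
        im' = image_seed (fun_of f') (mixing_subseed \<Sigma> I0' I1') \<Sigma>;
        a = (im = im');
        b = (mixing_subseed \<Sigma> I0 I1 = mixing_subseed \<Sigma> I0' I1');
        c = (\<exists>g I0'' I1''. mixing_pair \<Sigma> I0'' I1'' \<and> im' = mixing_subseed \<Sigma> I0'' I1'' \<and>
               seed_iso im im' g \<and>
               f' = par_comp \<Sigma> (comp_hom (id_par \<Sigma> I0'' I1'') g im) f)
    in ((f, f') \<in> green_R (End_par \<Sigma>) (par_comp \<Sigma>) \<longleftrightarrow> a) \<and>
       ((f, f') \<in> green_L (End_par \<Sigma>) (par_comp \<Sigma>) \<longleftrightarrow> b \<and> c) \<and>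
       ((f, f') \<in> green_H (End_par \<Sigma>) (par_comp \<Sigma>) \<longleftrightarrow> a \<and> b \<and> c) \<and>
       ((f, f') \<in> green_D (End_par \<Sigma>) (par_comp \<Sigma>) \<longleftrightarrow> isomorphic_seeds im im')"
proof -
  let ?im = "image_of \<Sigma> f" and ?im' = "image_of \<Sigma> f'"
  note S = assms(1) and f = assms(6) and f' = assms(7)
  let ?c = "\<exists>g I0'' I1''. mixing_pair \<Sigma> I0'' I1'' \<and> ?im' = mixing_subseed \<Sigma> I0'' I1'' \<and>
      seed_iso ?im ?im' g \<and> f' = par_comp \<Sigma> (comp_hom (id_par \<Sigma> I0'' I1'') g ?im) f"
  have m: "mixing \<Sigma> ?im'" using regular_image(3)[OF S f'] .
  have comp: "comp_hom (id_par \<Sigma> J0 J1) g ?im = restricted_hom ?im g"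
    if "?im' = mixing_subseed \<Sigma> J0 J1" "seed_iso ?im ?im' g" for J0 J1 g
    using that by (intro comp_hom_id_par) (auto simp: seed_iso_def bij_betw_def)
  have c: "?c \<longleftrightarrow> (\<exists>g. seed_iso ?im ?im' g \<and> f' = par_comp \<Sigma> (restricted_hom ?im g) f)"
  proof
    assume ?c
    then obtain g J0 J1 where J: "?im' = mixing_subseed \<Sigma> J0 J1" and g: "seed_iso ?im ?im' g"
      and fg: "f' = par_comp \<Sigma> (comp_hom (id_par \<Sigma> J0 J1) g ?im) f" by blast
    show "\<exists>g. seed_iso ?im ?im' g \<and> f' = par_comp \<Sigma> (restricted_hom ?im g) f"
      using g fg unfolding comp[OF J g] by blast
  next
    assume "\<exists>g. seed_iso ?im ?im' g \<and> f' = par_comp \<Sigma> (restricted_hom ?im g) f"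
    then obtain g where g: "seed_iso ?im ?im' g" and fg: "f' = par_comp \<Sigma> (restricted_hom ?im g) f"
      by blast
    obtain J0 J1 where J: "mixing_pair \<Sigma> J0 J1" "?im' = mixing_subseed \<Sigma> J0 J1"
      using m mixing_iff[OF S] by blast
    have "f' = par_comp \<Sigma> (comp_hom (id_par \<Sigma> J0 J1) g ?im) f"
      unfolding comp[OF J(2) g] by (rule fg)
    then show ?c using J g by blast
  qed
  have R: "(f, f') \<in> green_R (End_par \<Sigma>) (par_comp \<Sigma>) \<longleftrightarrow> ?im = ?im'"
    by (rule green_R_iff_same_image[OF S f f'])
  have L: "(f, f') \<in> green_L (End_par \<Sigma>) (par_comp \<Sigma>) \<longleftrightarrow> source f = source f' \<and> ?c"
    unfolding c using green_L_image_iso[OF S f] iso_after_regular(1)[OF S f m] by metis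
  have H: "(f, f') \<in> green_H (End_par \<Sigma>) (par_comp \<Sigma>) \<longleftrightarrow> ?im = ?im' \<and> source f = source f' \<and> ?c"
    unfolding green_H_def using L R by blast
  show ?thesis
    using R L H green_D_iff_isomorphic[OF S f f'] unfolding Let_def assms(3,5) by blast
qed

end
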